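(* Let $T$ be an automorphism of a standard Lebesgue probability space $(X,\mu)$ and, for an infinite set $P\subset\mathbb{Z}$, let $H_P(T)=\{S\in G:\ T^{-n}ST^{n}\to I,\ n\in P,\ n\to\infty\}$, where $G$ is the group of all automorphisms of $(X,\mu)$. (i) If $T$ is prime, then for every infinite set $P\subset\mathbb{Z}$ either the group $H_P(T)$ is ergodic or $H_P(T)=\{I\}$. (ii) For every automorphism $T$ and every infinite set $P\subset \mathbb{Z}$ the group $H_P(T)$ is full, i.e. $H_P(T)=[H_P(T)]$.
   Context: $(X,\mu)$ is a standard (non-atomic) Lebesgue probability space. $G$ is the group of all automorphisms of $(X,\mu)$, i.e. invertible bi-measurable $\mu$-preserving transformations, identified when equal $\mu$-almost everywhere; $I$ is the identity; products are compositions. Automorphisms are associated with the corresponding operators on $L_2(X,\mu)$, and convergence of automorphisms is strong operator convergence: $R_n\to I$ means $\mu(R_nA\,\triangle\,A)\to 0$ for every measurable $A\subset X$. For an infinite $P\subset\mathbb{Z}$, "$n\in P$, $n\to\infty$" means the limit along $P$ as $|n|\to\infty$ (all but finitely many $n\in P$ in every neighbourhood condition). $H_P(T)$ is a subgroup of $G$. $T$ is prime if its only invariant $\sigma$-algebras are trivial: every $\sigma$-subalgebra $\mathcal{A}$ of measurable sets (complete mod $\mu$) with $T\mathcal{A}=\mathcal{A}$ is either the algebra of sets of measure $0$ or $1$, or the algebra of all measurable sets. A subgroup $H\subset G$ is ergodic if every measurable $A$ with $\mu(SA\,\triangle\,A)=0$ for all $S\in H$ satisfies $\mu(A)\in\{0,1\}$.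 The full group $[S]$ of $S\in G$ is the set of all $R\in G$ for which there is an integer-valued function $n(x)$ with $R(x)=S^{n(x)}(x)$ for ($\mu$-almost) all $x\in X$. The full group $[\{S_g\}]$ of a family $\{S_g\}\subset G$ is the group generated by all the groups $[S_g]$. *)

theory Defs
  imports "HOL-Probability.Probability_Measure" "HOL-Algebra.Bij" "HOL-Algebra.Generated_Groups"
begin

(* Standard non-atomic Lebesgue probability space: complete, and isomorphic mod 0 to the
   unit interval with Lebesgue measure. *)
locale lebesgue_prob_space = prob_space M + complete_measure M for M :: "'a measure" +
  assumes iso_unit_interval:
    "\<exists>N\<in>null_sets M. \<exists>N'\<in>null_sets (lebesgue_on {0..1::real}). \<exists>f.
       bij_betw f (space M - N) ({0..1} - N') \<and>
       f \<in> restrict_space M (space M - N) \<rightarrow>\<^sub>M lebesgue_on ({0..1} - N') \<and>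
       inv_into (space M - N) f \<in> lebesgue_on ({0..1} - N') \<rightarrow>\<^sub>M restrict_space M (space M - N) \<and>
       distr (restrict_space M (space M - N)) (lebesgue_on ({0..1} - N')) f
         = lebesgue_on ({0..1} - N')"

(* Everywhere defined invertible bi-measurable measure-preserving maps, before any
   identification; as in BijGroup they are undefined outside the space. *)
definition pt_auts :: "'a measure \<Rightarrow> ('a \<Rightarrow> 'a) set" where
  "pt_auts M = {f \<in> Bij (space M). f \<in> M \<rightarrow>\<^sub>M M \<and> inv_into (space M) f \<in> M \<rightarrow>\<^sub>M M \<and> distr M M f = M}"

definition pt_aut_group :: "'a measure \<Rightarrow> ('a \<Rightarrow> 'a) monoid" where
  "pt_aut_group M = (BijGroup (space M))\<lparr>carrier := pt_auts M\<rparr>"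

definition null_auts :: "'a measure \<Rightarrow> ('a \<Rightarrow> 'a) set" where
  "null_auts M = {f \<in> pt_auts M. AE x in M. f x = x}"

(* The group G. Its elements, the cosets of the normal subgroup of maps that are almost
   everywhere the identity, are the classes of almost everywhere equal maps
   (see coset_eq_AE_class below). *)
definition aut_group :: "'a measure \<Rightarrow> ('a \<Rightarrow> 'a) set monoid" where
  "aut_group M = pt_aut_group M Mod null_auts M"

(* All uses below are independent of the choice of the representative. *)
definition rep :: "('a \<Rightarrow> 'a) set \<Rightarrow> 'a \<Rightarrow> 'a" where
  "rep C = (SOME f. f \<in> C)"

(* R n tends to I as n ranges over P and the absolute value of n tends to infinity. *)
definition tends_to_identity ::
    "'a measure \<Rightarrow> int set \<Rightarrow> (int \<Rightarrow> ('a \<Rightarrow> 'a) set) \<Rightarrow> bool" where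
  "tends_to_identity M P R \<longleftrightarrow>
     (\<forall>A\<in>sets M. ((\<lambda>n. measure M (sym_diff (rep (R n) ` A) A)) \<longlongrightarrow> 0) (inf cofinite (principal P)))"

definition H_group ::
    "'a measure \<Rightarrow> int set \<Rightarrow> ('a \<Rightarrow> 'a) set \<Rightarrow> ('a \<Rightarrow> 'a) set set" where
  "H_group M P T = {S \<in> carrier (aut_group M).
     tends_to_identity M P
       (\<lambda>n. T [^]\<^bsub>aut_group M\<^esub> (- n) \<otimes>\<^bsub>aut_group M\<^esub> S \<otimes>\<^bsub>aut_group M\<^esub> T [^]\<^bsub>aut_group M\<^esub> n)}"

definition prime_aut :: "'a measure \<Rightarrow> ('a \<Rightarrow> 'a) set \<Rightarrow> bool" where
  "prime_aut M T \<longleftrightarrow>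
     (\<forall>\<A>. sigma_algebra (space M) \<A> \<and> null_sets M \<subseteq> \<A> \<and> \<A> \<subseteq> sets M \<and>
           (\<lambda>A. rep T ` A) ` \<A> = \<A> \<longrightarrow>
        \<A> = {A \<in> sets M. measure M A = 0 \<or> measure M A = 1} \<or> \<A> = sets M)"

definition ergodic_subgroup :: "'a measure \<Rightarrow> ('a \<Rightarrow> 'a) set set \<Rightarrow> bool" where
  "ergodic_subgroup M H \<longleftrightarrow>
     subgroup H (aut_group M) \<and>
     (\<forall>A\<in>sets M. (\<forall>S\<in>H. measure M (sym_diff (rep S ` A) A) = 0) \<longrightarrow> measure M A \<in> {0, 1})"

(* The integer powers are the pointwise ones of a single representative of S. *)
definition full_group :: "'a measure \<Rightarrow> ('a \<Rightarrow> 'a) set \<Rightarrow> ('a \<Rightarrow> 'a) set set" where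
  "full_group M S = {R \<in> carrier (aut_group M).
     \<exists>k :: 'a \<Rightarrow> int. AE x in M. rep R x = (rep S [^]\<^bsub>pt_aut_group M\<^esub> k x) x}"

definition full_group_family :: "'a measure \<Rightarrow> ('a \<Rightarrow> 'a) set set \<Rightarrow> ('a \<Rightarrow> 'a) set set" where
  "full_group_family M F = generate (aut_group M) (\<Union>S\<in>F. full_group M S)"

lemma pt_auts_AE:
  assumes f: "f \<in> pt_auts M" and P: "AE x in M. P x"
  shows "AE x in M. P (f x)"
proof -
  have fm: "f \<in> M \<rightarrow>\<^sub>M M" and "distr M M f = M"
    using f by (auto simp: pt_auts_def)
  then have "AE x in distr M M f. P x"
    by (simp only: P)
  then show ?thesis
    using AE_distrD[OF fm] by blast
qed

lemma pt_auts_inv: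
  assumes f: "f \<in> pt_auts M"
  shows "restrict (inv_into (space M) f) (space M) \<in> pt_auts M"
proof -
  let ?g = "inv_into (space M) f" and ?h = "restrict (inv_into (space M) f) (space M)"
  have fB: "f \<in> Bij (space M)" and bij: "bij_betw f (space M) (space M)"
    and fm: "f \<in> M \<rightarrow>\<^sub>M M" and gm: "?g \<in> M \<rightarrow>\<^sub>M M" and d: "distr M M f = M"
    using f by (auto simp: pt_auts_def Bij_def)
  have hm: "?h \<in> M \<rightarrow>\<^sub>M M"
    using gm by (subst measurable_cong[where g = ?g]) auto
  have hf: "?h (f x) = x" if "x \<in> space M" for x
    using that bij by (simp add: bij_betwE bij_betw_inv_into_left)
  have hB: "?h \<in> Bij (space M)"
    using fB by (rule restrict_inv_into_Bij)
  have inv_h: "inv_into (space M) ?h x = f x" if x: "x \<in> space M" for x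
  proof (rule inv_into_f_eq)
    show "inj_on ?h (space M)" using hB by (simp add: Bij_def bij_betw_def)
    show "f x \<in> space M" using x bij by (simp add: bij_betwE)
    show "?h (f x) = x" using x by (rule hf)
  qed
  have "distr M M ?h = distr (distr M M f) M ?h"
    by (simp only: d)
  also have "\<dots> = distr M M (?h \<circ> f)"
    using hm fm by (rule distr_distr)
  also have "\<dots> = distr M M (\<lambda>x. x)"
    by (rule distr_cong) (simp_all only: o_apply hf)
  also have "\<dots> = M"
    by (simp add: distr_id2)
  finally have dh: "distr M M ?h = M" .
  have "inv_into (space M) ?h \<in> M \<rightarrow>\<^sub>M M"
    using fm by (subst measurable_cong[where g = f]) (simp_all add: inv_h)
  with hB hm dh show ?thesis
    by (simp add: pt_auts_def)
qed

lemma pt_auts_compose: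
  assumes f: "f \<in> pt_auts M" and g: "g \<in> pt_auts M"
  shows "compose (space M) f g \<in> pt_auts M"
proof -
  let ?c = "compose (space M) f g"
  have fB: "bij_betw f (space M) (space M)" and fm: "f \<in> M \<rightarrow>\<^sub>M M"
    and fi: "inv_into (space M) f \<in> M \<rightarrow>\<^sub>M M" and fd: "distr M M f = M"
    using f by (auto simp: pt_auts_def Bij_def)
  have gB: "bij_betw g (space M) (space M)" and gm: "g \<in> M \<rightarrow>\<^sub>M M"
    and gi: "inv_into (space M) g \<in> M \<rightarrow>\<^sub>M M" and gd: "distr M M g = M"
    using g by (auto simp: pt_auts_def Bij_def)
  have cB: "?c \<in> Bij (space M)"
    using f g by (auto simp: pt_auts_def intro: compose_Bij)
  have cm: "?c \<in> M \<rightarrow>\<^sub>M M"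
    using measurable_comp[OF gm fm]
    by (subst measurable_cong[where g = "f \<circ> g"]) (auto simp: compose_def)
  have "distr M M ?c = distr M M (f \<circ> g)"
    by (rule distr_cong) (auto simp: compose_def)
  also have "\<dots> = distr (distr M M g) M f"
    using fm gm by (rule distr_distr[symmetric])
  also have "\<dots> = M"
    by (simp only: fd gd)
  finally have dc: "distr M M ?c = M" .
  have ic: "inv_into (space M) ?c x = inv_into (space M) g (inv_into (space M) f x)"
    if x: "x \<in> space M" for x
  proof (rule inv_into_f_eq)
    show "inj_on ?c (space M)" using cB by (simp add: Bij_def bij_betw_def)
    have y: "inv_into (space M) f x \<in> space M"
      using x fi by (rule measurable_space[rotated])
    show z: "inv_into (space M) g (inv_into (space M) f x) \<in> space M"
      using y gi by (rule measurable_space[rotated])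
    show "?c (inv_into (space M) g (inv_into (space M) f x)) = x"
      using x y z fB gB by (simp add: compose_def bij_betw_inv_into_right)
  qed
  have "inv_into (space M) ?c \<in> M \<rightarrow>\<^sub>M M"
    using measurable_comp[OF fi gi]
    by (subst measurable_cong[where g = "inv_into (space M) g \<circ> inv_into (space M) f"])
       (auto simp: ic)
  with cB cm dc show ?thesis
    by (simp add: pt_auts_def)
qed

lemma mult_pt_aut_group:
  "f \<in> pt_auts M \<Longrightarrow> g \<in> pt_auts M \<Longrightarrow> f \<otimes>\<^bsub>pt_aut_group M\<^esub> g = compose (space M) f g"
  by (simp add: pt_aut_group_def BijGroup_def pt_auts_def)

lemma subgroup_pt_auts: "subgroup (pt_auts M) (BijGroup (space M))"
proof
  show "pt_auts M \<subseteq> carrier (BijGroup (space M))"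
    by (auto simp: pt_auts_def BijGroup_def)
  have "inv_into (space M) (\<lambda>x\<in>space M. x) x = x" if "x \<in> space M" for x
    using that by (intro inv_into_f_eq) (auto simp: inj_on_def)
  then have "inv_into (space M) (\<lambda>x\<in>space M. x) \<in> M \<rightarrow>\<^sub>M M"
    by (subst measurable_cong[where g = "\<lambda>x. x"]) auto
  moreover have "(\<lambda>x\<in>space M. x) \<in> M \<rightarrow>\<^sub>M M"
    by (subst measurable_cong[where g = "\<lambda>x. x"]) auto
  moreover have "distr M M (\<lambda>x\<in>space M. x) = distr M M (\<lambda>x. x)"
    by (rule distr_cong) auto
  ultimately show "\<one>\<^bsub>BijGroup (space M)\<^esub> \<in> pt_auts M"
    by (auto simp: pt_auts_def BijGroup_def id_Bij distr_id2)
  fix f assume f: "f \<in> pt_auts M"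
  then show "inv\<^bsub>BijGroup (space M)\<^esub> f \<in> pt_auts M"
    using pt_auts_inv[OF f] by (subst inv_BijGroup) (auto simp: pt_auts_def)
  fix g assume "g \<in> pt_auts M"
  with f show "f \<otimes>\<^bsub>BijGroup (space M)\<^esub> g \<in> pt_auts M"
    using pt_auts_compose[of f M g] by (auto simp: BijGroup_def pt_auts_def)
qed

lemma group_pt_aut_group: "group (pt_aut_group M)"
  unfolding pt_aut_group_def
  by (rule group.subgroup_imp_group[OF group_BijGroup subgroup_pt_auts])

lemma carrier_pt_aut_group [simp]: "carrier (pt_aut_group M) = pt_auts M"
  by (simp add: pt_aut_group_def)

lemma inv_pt_aut_group:
  "f \<in> pt_auts M \<Longrightarrow> inv\<^bsub>pt_aut_group M\<^esub> f = restrict (inv_into (space M) f) (space M)"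
  unfolding pt_aut_group_def
  using group.m_inv_consistent[OF group_BijGroup subgroup_pt_auts, of f M]
  by (simp add: inv_BijGroup pt_auts_def)

lemma normal_null_auts: "normal (null_auts M) (pt_aut_group M)"
proof -
  interpret G: group "pt_aut_group M" by (rule group_pt_aut_group)
  have sub: "null_auts M \<subseteq> pt_auts M"
    by (auto simp: null_auts_def)
  have inv_AE: "AE x in M. (inv\<^bsub>pt_aut_group M\<^esub> f) x = x" if f: "f \<in> null_auts M" for f
  proof -
    let ?h = "restrict (inv_into (space M) f) (space M)"
    have fa: "f \<in> pt_auts M" and "AE x in M. f x = x"
      using f by (auto simp: null_auts_def)
    then have "bij_betw f (space M) (space M)"
      by (auto simp: pt_auts_def Bij_def)
    then have h: "?h x = x" if "x \<in> space M" "f x = x" for x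
      using that bij_betw_inv_into_left[of f "space M" "space M" x] by simp
    from \<open>AE x in M. f x = x\<close> AE_space have "AE x in M. ?h x = x"
      by eventually_elim (rule h)
    then show ?thesis
      by (simp add: inv_pt_aut_group fa)
  qed
  have sg: "subgroup (null_auts M) (pt_aut_group M)"
  proof
    show "null_auts M \<subseteq> carrier (pt_aut_group M)" using sub by simp
    have "\<one>\<^bsub>pt_aut_group M\<^esub> \<in> pt_auts M"
      using G.one_closed by simp
    moreover have "AE x in M. \<one>\<^bsub>pt_aut_group M\<^esub> x = x"
      by (rule AE_I2) (simp add: pt_aut_group_def BijGroup_def)
    ultimately show "\<one>\<^bsub>pt_aut_group M\<^esub> \<in> null_auts M"
      by (simp add: null_auts_def)
    fix f assume f: "f \<in> null_auts M"
    then have fa: "f \<in> pt_auts M" and fe: "AE x in M. f x = x"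
      by (auto simp: null_auts_def)
    show "inv\<^bsub>pt_aut_group M\<^esub> f \<in> null_auts M"
      using G.inv_closed[of f] fa inv_AE[OF f] by (simp add: null_auts_def)
    fix g assume g: "g \<in> null_auts M"
    then have ga: "g \<in> pt_auts M" and ge: "AE x in M. g x = x"
      by (auto simp: null_auts_def)
    have "AE x in M. compose (space M) f g x = x"
      using fe ge AE_space by eventually_elim (simp add: compose_def)
    then show "f \<otimes>\<^bsub>pt_aut_group M\<^esub> g \<in> null_auts M"
      using pt_auts_compose[OF fa ga] by (simp add: null_auts_def mult_pt_aut_group fa ga)
  qed
  show ?thesis
  proof (rule G.normal_invI[OF sg])
    fix g f assume "g \<in> carrier (pt_aut_group M)" and f: "f \<in> null_auts M"
    then have ga: "g \<in> pt_auts M" and fa: "f \<in> pt_auts M" and fe: "AE x in M. f x = x"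
      by (auto simp: null_auts_def)
    let ?h = "restrict (inv_into (space M) g) (space M)"
    have bij: "bij_betw g (space M) (space M)"
      using ga by (simp add: pt_auts_def Bij_def)
    have ha: "?h \<in> pt_auts M" using ga by (rule pt_auts_inv)
    have "AE x in M. f (?h x) = ?h x"
      using ha fe by (rule pt_auts_AE)
    then have "AE x in M. compose (space M) (compose (space M) g f) ?h x = x"
      using AE_space
    proof eventually_elim
      case (elim x)
      then have "?h x \<in> space M" "g (?h x) = x"
        using bij bij_betw_apply[OF bij_betw_inv_into[OF bij]]
        by (simp_all add: bij_betw_inv_into_right)
      then show ?case
        using elim by (simp add: compose_def)
    qed
    moreover have "g \<otimes>\<^bsub>pt_aut_group M\<^esub> f \<otimes>\<^bsub>pt_aut_group M\<^esub> inv\<^bsub>pt_aut_group M\<^esub> g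
        = compose (space M) (compose (space M) g f) ?h"
      using ga fa ha by (simp add: inv_pt_aut_group mult_pt_aut_group pt_auts_compose)
    ultimately show "g \<otimes>\<^bsub>pt_aut_group M\<^esub> f \<otimes>\<^bsub>pt_aut_group M\<^esub> inv\<^bsub>pt_aut_group M\<^esub> g \<in> null_auts M"
      using ga fa ha by (simp add: null_auts_def pt_auts_compose)
  qed
qed

lemma group_aut_group: "group (aut_group M)"
  unfolding aut_group_def by (rule normal.factorgroup_is_group[OF normal_null_auts])

lemma coset_eq_AE_class:
  assumes f: "f \<in> pt_auts M"
  shows "null_auts M #>\<^bsub>pt_aut_group M\<^esub> f = {g \<in> pt_auts M. AE x in M. g x = f x}"
proof -
  interpret G: group "pt_aut_group M" by (rule group_pt_aut_group)
  let ?i = "restrict (inv_into (space M) f) (space M)"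
  have ia: "?i \<in> pt_auts M" using f by (rule pt_auts_inv)
  have bij: "bij_betw f (space M) (space M)"
    using f by (simp add: pt_auts_def Bij_def)
  show ?thesis
  proof (rule Set.set_eqI, rule iffI)
    fix g assume "g \<in> null_auts M #>\<^bsub>pt_aut_group M\<^esub> f"
    then obtain h where h: "h \<in> pt_auts M" "AE x in M. h x = x" and g: "g = compose (space M) h f"
      using f by (auto simp: r_coset_def null_auts_def mult_pt_aut_group)
    have "AE x in M. g x = f x"
      using pt_auts_AE[OF f h(2)] AE_space by eventually_elim (simp add: g compose_def)
    then show "g \<in> {g \<in> pt_auts M. AE x in M. g x = f x}"
      using pt_auts_compose[OF h(1) f] by (simp add: g)
  next
    fix g assume "g \<in> {g \<in> pt_auts M. AE x in M. g x = f x}"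
    then have g: "g \<in> pt_auts M" and ge: "AE x in M. g x = f x" by auto
    let ?h = "compose (space M) g ?i"
    have ha: "?h \<in> pt_auts M" using g ia by (rule pt_auts_compose)
    have "AE x in M. ?h x = x"
      using pt_auts_AE[OF ia ge] AE_space
      by eventually_elim (use bij in \<open>simp add: compose_def bij_betw_inv_into_right\<close>)
    with ha have "?h \<in> null_auts M" by (simp add: null_auts_def)
    moreover have "g = ?h \<otimes>\<^bsub>pt_aut_group M\<^esub> f"
      using G.inv_solve_right'[of ?h g f] f g ia ha
      by (simp add: inv_pt_aut_group mult_pt_aut_group)
    ultimately show "g \<in> null_auts M #>\<^bsub>pt_aut_group M\<^esub> f"
      by (auto simp: r_coset_def)
  qed
qed

end

theory Submission
  imports Defs
begin

text \<open>
  Everything is expressed through the \<^emph>\<open>displacement\<close> of a set \<open>A\<close> by a map \<open>s\<close>, the measure of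
  the points where exactly one of \<open>s x \<in> A\<close> and \<open>x \<in> A\<close> holds. For a measure preserving
  bijection it equals \<open>\<mu>(s A \<triangle> A)\<close>, but since it does not involve images, it plainly
  depends only on the class of \<open>s\<close> modulo null sets. It is subadditive under composition, unchanged by passing to the
  inverse, and the displacement of \<open>A\<close> by \<open>g\<^sup>-\<^sup>1 s g\<close> is that of \<open>g A\<close> by \<open>s\<close>. So \<open>S\<close> lies in
  \<open>H = H\<^sub>P(T)\<close> iff \<open>S\<close> displaces \<open>T\<^sup>n A\<close> by a measure tending to 0 along \<open>P\<close>, for every \<open>A\<close>.
  With these rules \<open>H\<close> is a subgroup, and it is normalised by \<open>T\<close> because \<open>T\<close> commutes with
  its own powers.

  Fullness (\<open>asymp_central_full\<close>, \<open>H_group_full\<close>): let \<open>R x = S\<^bsup>k(x)\<^esup> x\<close> with \<open>S\<close> in \<open>H\<close>. Outside the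
  set \<open>B\<^sub>J\<close> of points where \<open>R\<close> agrees with none of the powers \<open>S\<^sup>j\<close>, \<open>\<bar>j\<bar> \<le> J\<close>, a point that \<open>R\<close>
  moves into or out of a set is moved so by one of these powers. Hence the displacement by \<open>R\<close>
  is at most the sum of those by finitely many \<open>S\<^sup>j\<close>, which tend to 0 since \<open>H\<close> is a group,
  plus \<open>\<mu>(B\<^sub>J)\<close>, which does not depend on \<open>n\<close> and is small for large \<open>J\<close>.

  The dichotomy (\<open>ergodic_or_trivial_if_prime\<close>): the \<open>H\<close>-invariant sets form a \<open>\<sigma>\<close>-algebra, and
  it is \<open>T\<close>-invariant since \<open>T\<close> normalises \<open>H\<close>. For prime \<open>T\<close> it is trivial, and then \<open>H\<close> is
  ergodic, or it is everything, and then \<open>H\<close> is trivial, because on a Lebesgue space a map that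
  preserves every measurable set up to null sets is almost everywhere the identity
  (\<open>AE_eq_id_if_all_invariant\<close>).

  The isomorphism with the unit interval is used twice, each time only through a real-valued
  measurable function that is injective off a null set: for the last fact, and for the measurability
  of the set where two automorphisms agree (\<open>coincidence_set\<close>).
\<close>

section \<open>Point maps and their classes\<close>

definition aut_class :: "'a measure \<Rightarrow> ('a \<Rightarrow> 'a) \<Rightarrow> ('a \<Rightarrow> 'a) set" where
  "aut_class M f = null_auts M #>\<^bsub>pt_aut_group M\<^esub> f"

lemma aut_class_hom: "group_hom (pt_aut_group M) (aut_group M) (aut_class M)"
proof -
  interpret N: normal "null_auts M" "pt_aut_group M" by (rule normal_null_auts)
  have "aut_class M \<in> hom (pt_aut_group M) (aut_group M)"
    using N.r_coset_hom_Mod by (simp add: aut_class_def [abs_def] aut_group_def)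
  then show ?thesis
    by (intro group_hom.intro group_hom_axioms.intro group_pt_aut_group group_aut_group)
qed

lemma aut_class_eqI:
  assumes "f \<in> pt_auts M" "g \<in> pt_auts M" "AE x in M. f x = g x"
  shows "aut_class M f = aut_class M g"
proof -
  have "(AE x in M. h x = f x) \<longleftrightarrow> (AE x in M. h x = g x)" for h
    using assms(3) by (auto elim: AE_mp)
  then show ?thesis
    using assms(1,2) by (simp add: aut_class_def coset_eq_AE_class)
qed

lemma rep_aut_class:
  assumes "f \<in> pt_auts M"
  shows "rep (aut_class M f) \<in> pt_auts M" "AE x in M. rep (aut_class M f) x = f x"
proof -
  have "f \<in> aut_class M f"
    using assms by (simp add: aut_class_def coset_eq_AE_class)
  then have "rep (aut_class M f) \<in> aut_class M f"
    using someI[of "\<lambda>g. g \<in> aut_class M f" f] by (simp add: rep_def)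
  then show "rep (aut_class M f) \<in> pt_auts M" "AE x in M. rep (aut_class M f) x = f x"
    using assms by (simp_all add: aut_class_def coset_eq_AE_class)
qed

lemma
  assumes "S \<in> carrier (aut_group M)"
  shows rep_in_pt_auts: "rep S \<in> pt_auts M" and aut_class_rep: "aut_class M (rep S) = S"
proof -
  obtain f where f: "f \<in> pt_auts M" "S = aut_class M f"
    using assms by (auto simp: aut_group_def FactGroup_def RCOSETS_def aut_class_def)
  then show "rep S \<in> pt_auts M" "aut_class M (rep S) = S"
    using rep_aut_class[OF f(1)] aut_class_eqI[of "rep S" M f] by auto
qed

lemma pt_auts_space: "f \<in> pt_auts M \<Longrightarrow> x \<in> space M \<Longrightarrow> f x \<in> space M"
  by (auto simp: pt_auts_def intro: measurable_space)

lemma pt_auts_measurable: "f \<in> pt_auts M \<Longrightarrow> f \<in> M \<rightarrow>\<^sub>M M"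
  by (simp add: pt_auts_def)

lemma pt_auts_inj: "f \<in> pt_auts M \<Longrightarrow> inj_on f (space M)"
  by (simp add: pt_auts_def Bij_def bij_betw_def)

lemma inv_pt_auts: "f \<in> pt_auts M \<Longrightarrow> inv\<^bsub>pt_aut_group M\<^esub> f \<in> pt_auts M"
  using group.inv_closed[OF group_pt_aut_group, of f M] by simp

lemma mult_apply:
  "f \<in> pt_auts M \<Longrightarrow> g \<in> pt_auts M \<Longrightarrow> x \<in> space M \<Longrightarrow> (f \<otimes>\<^bsub>pt_aut_group M\<^esub> g) x = f (g x)"
  by (simp add: mult_pt_aut_group compose_def)

lemma one_apply: "x \<in> space M \<Longrightarrow> \<one>\<^bsub>pt_aut_group M\<^esub> x = x"
  by (simp add: pt_aut_group_def BijGroup_def)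

lemma inv_apply_left:
  assumes "f \<in> pt_auts M" "x \<in> space M"
  shows "(inv\<^bsub>pt_aut_group M\<^esub> f) (f x) = x"
  using group.l_inv[OF group_pt_aut_group, of f M] mult_apply[OF inv_pt_auts, of f M f x] assms
  by (simp add: one_apply)

lemma inv_apply_right:
  assumes "f \<in> pt_auts M" "x \<in> space M"
  shows "f ((inv\<^bsub>pt_aut_group M\<^esub> f) x) = x"
  using group.r_inv[OF group_pt_aut_group, of f M] mult_apply[OF _ inv_pt_auts, of f M f x] assms
  by (simp add: one_apply)

text \<open>Images under an automorphism are preimages under its inverse, so that measurability of
  images reduces to measurability of maps.\<close>

lemma image_eq_inv_vimage:
  assumes f: "f \<in> pt_auts M" and A: "A \<subseteq> space M"
  shows "f ` A = (inv\<^bsub>pt_aut_group M\<^esub> f) -` A \<inter> space M"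
proof (intro equalityI subsetI)
  fix y assume "y \<in> (inv\<^bsub>pt_aut_group M\<^esub> f) -` A \<inter> space M"
  then show "y \<in> f ` A"
    using inv_apply_right[OF f, of y] by (metis IntE image_eqI vimageD)
qed (use A pt_auts_space[OF f] inv_apply_left[OF f] in auto)

lemma pt_auts_image_sets:
  assumes "f \<in> pt_auts M" "A \<in> sets M"
  shows "f ` A \<in> sets M"
  using assms measurable_sets[OF pt_auts_measurable[OF inv_pt_auts[OF assms(1)]] assms(2)]
  by (simp add: image_eq_inv_vimage sets.sets_into_space)

lemma measure_pt_auts_vimage:
  assumes "f \<in> pt_auts M" "A \<in> sets M"
  shows "measure M (f -` A \<inter> space M) = measure M A"
  using measure_distr[OF pt_auts_measurable[OF assms(1)] assms(2)] assms(1)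
  by (simp add: pt_auts_def)


section \<open>Displacement of a set\<close>

definition displacement :: "'a measure \<Rightarrow> ('a \<Rightarrow> 'a) \<Rightarrow> 'a set \<Rightarrow> real" where
  "displacement M f A = measure M {x \<in> space M. (f x \<in> A) \<noteq> (x \<in> A)}"

lemma displacement_sets:
  assumes "f \<in> pt_auts M" "A \<in> sets M"
  shows "{x \<in> space M. (f x \<in> A) \<noteq> (x \<in> A)} \<in> sets M"
proof -
  have [measurable]: "f \<in> M \<rightarrow>\<^sub>M M" "A \<in> sets M"
    using assms by (auto intro: pt_auts_measurable)
  show ?thesis by measurable
qed

text \<open>The preimage of \<open>f A \<triangle> A\<close> under \<open>f\<close> is the set of points whose membership in \<open>A\<close> changes
  under \<open>f\<close>.\<close>

lemma measure_image_sym_diff: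
  assumes f: "f \<in> pt_auts M" and A: "A \<in> sets M"
  shows "measure M (sym_diff (f ` A) A) = displacement M f A"
proof -
  have sp: "A \<subseteq> space M" using A by (rule sets.sets_into_space)
  have "f -` sym_diff (f ` A) A \<inter> space M = {x \<in> space M. (f x \<in> A) \<noteq> (x \<in> A)}"
    using sp inj_on_image_mem_iff[OF pt_auts_inj[OF f], of _ A] by auto
  then show ?thesis
    using measure_pt_auts_vimage[OF f, of "sym_diff (f ` A) A"] pt_auts_image_sets[OF f A] A
    by (simp add: displacement_def)
qed

lemma displacement_cong_AE:
  assumes "f \<in> pt_auts M" "g \<in> pt_auts M" "AE x in M. f x = g x" "A \<in> sets M"
  shows "displacement M f A = displacement M g A"
  unfolding displacement_def
proof (rule measure_eq_AE)
  show "AE x in M. x \<in> {x \<in> space M. (f x \<in> A) \<noteq> (x \<in> A)} \<longleftrightarrow>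
      x \<in> {x \<in> space M. (g x \<in> A) \<noteq> (x \<in> A)}"
    using assms(3) by eventually_elim simp
qed (rule displacement_sets[OF assms(1,4)], rule displacement_sets[OF assms(2,4)])

text \<open>Conjugation can be moved from the map to the set: \<open>g\<close> maps the points moved into or out
  of \<open>A\<close> by \<open>g\<^sup>-\<^sup>1 f g\<close> onto those moved into or out of \<open>g A\<close> by \<open>f\<close>. This turns convergence of
  the conjugates \<open>T\<^sup>-\<^sup>n S T\<^sup>n\<close> on \<open>A\<close> into a property of the single map \<open>S\<close> on the moving sets
  \<open>T\<^sup>n A\<close>.\<close>

lemma displacement_conj:
  assumes f: "f \<in> pt_auts M" and g: "g \<in> pt_auts M" and A: "A \<in> sets M"
  shows "displacement M (inv\<^bsub>pt_aut_group M\<^esub> g \<otimes>\<^bsub>pt_aut_group M\<^esub> f \<otimes>\<^bsub>pt_aut_group M\<^esub> g) A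
    = displacement M f (g ` A)"
proof -
  interpret G: group "pt_aut_group M" by (rule group_pt_aut_group)
  let ?h = "inv\<^bsub>pt_aut_group M\<^esub> g \<otimes>\<^bsub>pt_aut_group M\<^esub> f \<otimes>\<^bsub>pt_aut_group M\<^esub> g"
  have sp: "A \<subseteq> space M" using A by (rule sets.sets_into_space)
  have ig: "inv\<^bsub>pt_aut_group M\<^esub> g \<in> pt_auts M" using g by (rule inv_pt_auts)
  have h: "?h x = (inv\<^bsub>pt_aut_group M\<^esub> g) (f (g x))" if "x \<in> space M" for x
    using that f g ig G.m_closed[of "inv\<^bsub>pt_aut_group M\<^esub> g" f]
    by (simp add: mult_apply pt_auts_space)
  have "{x \<in> space M. (?h x \<in> A) \<noteq> (x \<in> A)}
      = g -` {y \<in> space M. (f y \<in> g ` A) \<noteq> (y \<in> g ` A)} \<inter> space M"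
    using f g ig
    by (auto simp: h image_eq_inv_vimage[OF g sp] inv_apply_left pt_auts_space)
  then show ?thesis
    using measure_pt_auts_vimage[OF g displacement_sets[OF f pt_auts_image_sets[OF g A]]]
    by (simp add: displacement_def)
qed

lemma displacement_one [simp]: "displacement M \<one>\<^bsub>pt_aut_group M\<^esub> A = 0"
proof -
  have "{x \<in> space M. (\<one>\<^bsub>pt_aut_group M\<^esub> x \<in> A) \<noteq> (x \<in> A)} = {}"
    by (auto simp: one_apply)
  then show ?thesis by (simp only: displacement_def measure_empty)
qed

lemma displacement_inv:
  assumes f: "f \<in> pt_auts M" and A: "A \<in> sets M"
  shows "displacement M (inv\<^bsub>pt_aut_group M\<^esub> f) A = displacement M f A"
proof -
  let ?g = "inv\<^bsub>pt_aut_group M\<^esub> f"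
  have "f -` {x \<in> space M. (?g x \<in> A) \<noteq> (x \<in> A)} \<inter> space M
      = {x \<in> space M. (f x \<in> A) \<noteq> (x \<in> A)}"
    using f by (auto simp: inv_apply_left pt_auts_space)
  then show ?thesis
    using measure_pt_auts_vimage[OF f displacement_sets[OF inv_pt_auts[OF f] A]]
    by (simp add: displacement_def)
qed

lemma (in finite_measure) displacement_mult_le:
  assumes f: "f \<in> pt_auts M" and g: "g \<in> pt_auts M" and A: "A \<in> sets M"
  shows "displacement M (f \<otimes>\<^bsub>pt_aut_group M\<^esub> g) A \<le> displacement M f A + displacement M g A"
proof -
  let ?D = "\<lambda>f. {x \<in> space M. (f x \<in> A) \<noteq> (x \<in> A)}"
  have s: "g -` ?D f \<inter> space M \<in> sets M"
    using measurable_sets[OF pt_auts_measurable[OF g] displacement_sets[OF f A]] .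
  have "measure M (?D (f \<otimes>\<^bsub>pt_aut_group M\<^esub> g)) \<le> measure M ((g -` ?D f \<inter> space M) \<union> ?D g)"
    by (rule finite_measure_mono)
       (use f g s displacement_sets[OF g A] in \<open>auto simp: mult_apply pt_auts_space\<close>)
  also have "\<dots> \<le> measure M (g -` ?D f \<inter> space M) + measure M (?D g)"
    by (rule measure_Un_le[OF s displacement_sets[OF g A]])
  also have "measure M (g -` ?D f \<inter> space M) = measure M (?D f)"
    by (rule measure_pt_auts_vimage[OF g displacement_sets[OF f A]])
  finally show ?thesis by (simp add: displacement_def)
qed

lemma (in finite_measure) displacement_eq_0_iff:
  assumes "f \<in> pt_auts M" "A \<in> sets M"
  shows "displacement M f A = 0 \<longleftrightarrow> (AE x in M. f x \<in> A \<longleftrightarrow> x \<in> A)"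
  using AE_iff_measurable[OF displacement_sets[OF assms], of "\<lambda>x. f x \<in> A \<longleftrightarrow> x \<in> A"]
  by (simp add: displacement_def emeasure_eq_measure)


section \<open>The group of asymptotically centralised maps\<close>

definition conj_pow :: "'a measure \<Rightarrow> ('a \<Rightarrow> 'a) \<Rightarrow> int \<Rightarrow> ('a \<Rightarrow> 'a) \<Rightarrow> 'a \<Rightarrow> 'a" where
  "conj_pow M t n s =
     t [^]\<^bsub>pt_aut_group M\<^esub> (- n) \<otimes>\<^bsub>pt_aut_group M\<^esub> s \<otimes>\<^bsub>pt_aut_group M\<^esub> t [^]\<^bsub>pt_aut_group M\<^esub> n"

lemma pow_pt_auts: "t \<in> pt_auts M \<Longrightarrow> t [^]\<^bsub>pt_aut_group M\<^esub> (n :: int) \<in> pt_auts M"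
  using group.int_pow_closed[OF group_pt_aut_group, of t M n] by simp

lemma mult_pt_auts:
  "f \<in> pt_auts M \<Longrightarrow> g \<in> pt_auts M \<Longrightarrow> f \<otimes>\<^bsub>pt_aut_group M\<^esub> g \<in> pt_auts M"
  by (simp add: mult_pt_aut_group pt_auts_compose)

lemma conj_pow_pt_auts: "t \<in> pt_auts M \<Longrightarrow> s \<in> pt_auts M \<Longrightarrow> conj_pow M t n s \<in> pt_auts M"
  by (simp add: conj_pow_def mult_pt_auts pow_pt_auts)

lemma conj_pow_eq:
  "t \<in> pt_auts M \<Longrightarrow> conj_pow M t (n :: int) s =
     inv\<^bsub>pt_aut_group M\<^esub> (t [^]\<^bsub>pt_aut_group M\<^esub> n) \<otimes>\<^bsub>pt_aut_group M\<^esub> s \<otimes>\<^bsub>pt_aut_group M\<^esub> t [^]\<^bsub>pt_aut_group M\<^esub> n"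
  using group.int_pow_neg[OF group_pt_aut_group, of t M n] by (simp add: conj_pow_def)

lemma displacement_conj_pow:
  assumes "t \<in> pt_auts M" "s \<in> pt_auts M" "A \<in> sets M"
  shows "displacement M (conj_pow M t n s) A
    = displacement M s ((t [^]\<^bsub>pt_aut_group M\<^esub> n) ` A)"
  using assms by (simp add: conj_pow_eq displacement_conj pow_pt_auts)

text \<open>Convergence of the conjugates of \<open>s\<close> to the identity, with the conjugation moved from
  \<open>s\<close> to the sets, and stated for point maps instead of classes.\<close>

definition asymp_central ::
    "'a measure \<Rightarrow> int set \<Rightarrow> ('a \<Rightarrow> 'a) \<Rightarrow> ('a \<Rightarrow> 'a) \<Rightarrow> bool" where
  "asymp_central M P t s \<longleftrightarrow> (\<forall>A\<in>sets M.
     ((\<lambda>n. displacement M s ((t [^]\<^bsub>pt_aut_group M\<^esub> n) ` A)) \<longlongrightarrow> 0) (inf cofinite (principal P)))"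

text \<open>Taking classes is a homomorphism, so the representative chosen for \<open>T\<^sup>-\<^sup>n S T\<^sup>n\<close> agrees almost
  everywhere with the same expression in any point maps that represent \<open>T\<close> and \<open>S\<close>, and hence
  displaces sets equally.\<close>

lemma aut_class_in_H_group_iff:
  assumes t: "t \<in> pt_auts M" and s: "s \<in> pt_auts M"
  shows "aut_class M s \<in> H_group M P (aut_class M t) \<longleftrightarrow> asymp_central M P t s"
proof -
  interpret c: group_hom "pt_aut_group M" "aut_group M" "aut_class M" by (rule aut_class_hom)
  let ?R = "\<lambda>n. aut_class M t [^]\<^bsub>aut_group M\<^esub> (- n) \<otimes>\<^bsub>aut_group M\<^esub> aut_class M s
    \<otimes>\<^bsub>aut_group M\<^esub> aut_class M t [^]\<^bsub>aut_group M\<^esub> n"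
  have R: "?R n = aut_class M (conj_pow M t n s)" for n :: int
    using t s mult_pt_auts[OF pow_pt_auts[OF t, of "-n"] s]
    by (simp add: conj_pow_def c.hom_int_pow[symmetric] pow_pt_auts)
  have "measure M (sym_diff (rep (?R n) ` A) A) = displacement M s ((t [^]\<^bsub>pt_aut_group M\<^esub> n) ` A)"
    if A: "A \<in> sets M" for n :: int and A
  proof -
    have q: "conj_pow M t n s \<in> pt_auts M" by (rule conj_pow_pt_auts[OF t s])
    note r = rep_aut_class[OF q]
    show ?thesis
      unfolding R measure_image_sym_diff[OF r(1) A] displacement_cong_AE[OF r(1) q r(2) A]
      by (rule displacement_conj_pow[OF t s A])
  qed
  then show ?thesis
    using s by (simp add: H_group_def tends_to_identity_def asymp_central_def)
qed

lemma H_group_iff: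
  assumes "t \<in> pt_auts M"
  shows "S \<in> H_group M P (aut_class M t) \<longleftrightarrow>
    S \<in> carrier (aut_group M) \<and> asymp_central M P t (rep S)"
  using aut_class_in_H_group_iff[OF assms, of "rep S" P] rep_in_pt_auts[of S M] aut_class_rep[of S M]
  by (auto simp: H_group_def)

lemma (in finite_measure) asymp_central_subgroup:
  assumes t: "t \<in> pt_auts M"
  shows "subgroup {s \<in> pt_auts M. asymp_central M P t s} (pt_aut_group M)"
proof
  interpret G: group "pt_aut_group M" by (rule group_pt_aut_group)
  let ?F = "inf cofinite (principal P)"
  let ?B = "\<lambda>A n. (t [^]\<^bsub>pt_aut_group M\<^esub> (n :: int)) ` A"
  have B: "?B A n \<in> sets M" if "A \<in> sets M" for A n
    using that t by (simp add: pt_auts_image_sets pow_pt_auts)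
  show "{s \<in> pt_auts M. asymp_central M P t s} \<subseteq> carrier (pt_aut_group M)" by auto
  show "\<one>\<^bsub>pt_aut_group M\<^esub> \<in> {s \<in> pt_auts M. asymp_central M P t s}"
    using G.one_closed by (simp add: asymp_central_def)
  fix f assume f: "f \<in> {s \<in> pt_auts M. asymp_central M P t s}"
  then show "inv\<^bsub>pt_aut_group M\<^esub> f \<in> {s \<in> pt_auts M. asymp_central M P t s}"
    by (simp add: asymp_central_def displacement_inv B inv_pt_auts)
  fix g assume g: "g \<in> {s \<in> pt_auts M. asymp_central M P t s}"
  have "((\<lambda>n. displacement M (f \<otimes>\<^bsub>pt_aut_group M\<^esub> g) (?B A n)) \<longlongrightarrow> 0) ?F" if A: "A \<in> sets M" for A
  proof (rule tendsto_sandwich[OF _ _ tendsto_const])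
    show "((\<lambda>n. displacement M f (?B A n) + displacement M g (?B A n)) \<longlongrightarrow> 0) ?F"
      using f g A by (auto simp: asymp_central_def intro: tendsto_add_zero)
    show "\<forall>\<^sub>F n in ?F. displacement M (f \<otimes>\<^bsub>pt_aut_group M\<^esub> g) (?B A n)
        \<le> displacement M f (?B A n) + displacement M g (?B A n)"
      using f g by (intro always_eventually allI displacement_mult_le B A) auto
  qed (simp add: displacement_def)
  with f g show "f \<otimes>\<^bsub>pt_aut_group M\<^esub> g \<in> {s \<in> pt_auts M. asymp_central M P t s}"
    by (simp add: asymp_central_def mult_pt_auts)
qed

lemma (in finite_measure) H_group_subgroup:
  assumes t: "t \<in> pt_auts M"
  shows "subgroup (H_group M P (aut_class M t)) (aut_group M)"
proof -
  interpret c: group_hom "pt_aut_group M" "aut_group M" "aut_class M" by (rule aut_class_hom)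
  have "H_group M P (aut_class M t) = aut_class M ` {s \<in> pt_auts M. asymp_central M P t s}"
    using aut_class_in_H_group_iff[OF t, of _ P] H_group_iff[OF t, of _ P]
    by (auto simp: image_iff) (metis rep_in_pt_auts aut_class_rep)
  then show ?thesis
    using c.subgroup_img_is_subgroup[OF asymp_central_subgroup[OF t]] by simp
qed

text \<open>Conjugating \<open>s\<close> by \<open>u\<close> replaces the sets \<open>T\<^sup>n A\<close> by \<open>u T\<^sup>n A = T\<^sup>n (u A)\<close>, to which the hypothesis on \<open>s\<close>
  applies with \<open>u A\<close> in place of \<open>A\<close>.\<close>

lemma asymp_central_conj:
  assumes t: "t \<in> pt_auts M" and s: "s \<in> pt_auts M" and st: "asymp_central M P t s"
    and u: "u \<in> pt_auts M"
    and comm: "\<And>n. u \<otimes>\<^bsub>pt_aut_group M\<^esub> t [^]\<^bsub>pt_aut_group M\<^esub> (n :: int)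
      = t [^]\<^bsub>pt_aut_group M\<^esub> n \<otimes>\<^bsub>pt_aut_group M\<^esub> u"
  shows "asymp_central M P t (inv\<^bsub>pt_aut_group M\<^esub> u \<otimes>\<^bsub>pt_aut_group M\<^esub> s \<otimes>\<^bsub>pt_aut_group M\<^esub> u)"
  unfolding asymp_central_def
proof
  fix A assume A: "A \<in> sets M"
  have "u ` (t [^]\<^bsub>pt_aut_group M\<^esub> n) ` A = (t [^]\<^bsub>pt_aut_group M\<^esub> n) ` u ` A" for n :: int
  proof -
    have "u ((t [^]\<^bsub>pt_aut_group M\<^esub> n) x) = (t [^]\<^bsub>pt_aut_group M\<^esub> n) (u x)" if "x \<in> A" for x
      using fun_cong[OF comm, of n x] sets.sets_into_space[OF A] that u t
      by (auto simp: mult_apply pow_pt_auts)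
    then show ?thesis by (simp add: image_image)
  qed
  then show "((\<lambda>n. displacement M (inv\<^bsub>pt_aut_group M\<^esub> u \<otimes>\<^bsub>pt_aut_group M\<^esub> s \<otimes>\<^bsub>pt_aut_group M\<^esub> u)
      ((t [^]\<^bsub>pt_aut_group M\<^esub> n) ` A)) \<longlongrightarrow> 0) (inf cofinite (principal P))"
    using st A u t s pt_auts_image_sets[OF u A]
    by (simp add: displacement_conj pt_auts_image_sets pow_pt_auts asymp_central_def)
qed


section \<open>Invariant sets\<close>

text \<open>Invariance is required up to null sets and separately for each map in \<open>K\<close>; the exceptional
  null set may depend on the map, so \<open>K\<close> can be uncountable.\<close>

definition invariant_sets :: "'a measure \<Rightarrow> ('a \<Rightarrow> 'a) set \<Rightarrow> 'a set set" where
  "invariant_sets M K = {A \<in> sets M. \<forall>s\<in>K. AE x in M. s x \<in> A \<longleftrightarrow> x \<in> A}"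

lemma invariant_sets_sigma_algebra:
  assumes K: "K \<subseteq> pt_auts M"
  shows "sigma_algebra (space M) (invariant_sets M K)"
  unfolding sigma_algebra_iff2
proof (intro conjI ballI allI impI)
  show "invariant_sets M K \<subseteq> Pow (space M)"
    by (auto simp: invariant_sets_def dest: sets.sets_into_space)
  show "{} \<in> invariant_sets M K" by (simp add: invariant_sets_def)
  fix A assume A: "A \<in> invariant_sets M K"
  have "AE x in M. s x \<in> space M - A \<longleftrightarrow> x \<in> space M - A" if "s \<in> K" for s
  proof -
    have "AE x in M. s x \<in> A \<longleftrightarrow> x \<in> A" using A that by (simp add: invariant_sets_def)
    then show ?thesis
      using AE_space by eventually_elim (use that K in \<open>auto simp: pt_auts_space\<close>)
  qed
  then show "space M - A \<in> invariant_sets M K"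
    using A by (auto simp: invariant_sets_def)
next
  fix A :: "nat \<Rightarrow> 'a set" assume A: "range A \<subseteq> invariant_sets M K"
  have "AE x in M. s x \<in> (\<Union>i. A i) \<longleftrightarrow> x \<in> (\<Union>i. A i)" if "s \<in> K" for s
  proof -
    have "AE x in M. \<forall>i. s x \<in> A i \<longleftrightarrow> x \<in> A i"
      unfolding AE_all_countable using A that by (auto simp: invariant_sets_def)
    then show ?thesis by eventually_elim simp
  qed
  moreover have "(\<Union>i. A i) \<in> sets M"
    using A by (intro sets.countable_UN) (auto simp: invariant_sets_def)
  ultimately show "(\<Union>i. A i) \<in> invariant_sets M K"
    by (simp add: invariant_sets_def)
qed

lemma null_sets_subset_invariant_sets:
  assumes K: "K \<subseteq> pt_auts M"
  shows "null_sets M \<subseteq> invariant_sets M K"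
proof
  fix N assume N: "N \<in> null_sets M"
  have "AE x in M. s x \<in> N \<longleftrightarrow> x \<in> N" if "s \<in> K" for s
  proof -
    have "s \<in> pt_auts M" using that K by auto
    from pt_auts_AE[OF this AE_not_in[OF N]] AE_not_in[OF N] show ?thesis
      by eventually_elim simp
  qed
  then show "N \<in> invariant_sets M K"
    using N by (auto simp: invariant_sets_def)
qed

text \<open>If \<open>A\<close> is invariant under \<open>u\<^sup>-\<^sup>1 s u\<close>, then \<open>u A\<close> is invariant under \<open>s\<close>; so a map that
  conjugates \<open>K\<close> into itself preserves invariance.\<close>

lemma (in finite_measure) image_in_invariant_sets:
  assumes K: "K \<subseteq> pt_auts M" and u: "u \<in> pt_auts M"
    and conj: "\<And>s. s \<in> K \<Longrightarrow> inv\<^bsub>pt_aut_group M\<^esub> u \<otimes>\<^bsub>pt_aut_group M\<^esub> s \<otimes>\<^bsub>pt_aut_group M\<^esub> u \<in> K"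
    and A: "A \<in> invariant_sets M K"
  shows "u ` A \<in> invariant_sets M K"
proof -
  have As: "A \<in> sets M" using A by (simp add: invariant_sets_def)
  have uA: "u ` A \<in> sets M" by (rule pt_auts_image_sets[OF u As])
  have "AE x in M. s x \<in> u ` A \<longleftrightarrow> x \<in> u ` A" if s: "s \<in> K" for s
  proof -
    have sp: "s \<in> pt_auts M" using s K by auto
    let ?c = "inv\<^bsub>pt_aut_group M\<^esub> u \<otimes>\<^bsub>pt_aut_group M\<^esub> s \<otimes>\<^bsub>pt_aut_group M\<^esub> u"
    have c: "?c \<in> pt_auts M" using conj[OF s] K by auto
    have "displacement M ?c A = 0"
      unfolding displacement_eq_0_iff[OF c As] using A conj[OF s] by (simp add: invariant_sets_def)
    then show ?thesis
      unfolding displacement_conj[OF sp u As] displacement_eq_0_iff[OF sp uA] .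
  qed
  with uA show ?thesis by (simp add: invariant_sets_def)
qed


section \<open>A coordinate on the space\<close>

lemma (in lebesgue_prob_space) obtain_coordinate:
  obtains \<phi> :: "'a \<Rightarrow> real" and N where
    "\<phi> \<in> borel_measurable M" "N \<in> null_sets M" "inj_on \<phi> (space M - N)"
proof -
  obtain N N' f where N: "N \<in> null_sets M" and f: "bij_betw f (space M - N) ({0..1} - N')"
    and fm: "f \<in> restrict_space M (space M - N) \<rightarrow>\<^sub>M lebesgue_on ({0..1::real} - N')"
    using iso_unit_interval by blast
  have "(\<lambda>y. y) \<in> lebesgue_on ({0..1::real} - N') \<rightarrow>\<^sub>M borel"
    by (intro measurable_restrict_space1 measurable_completion) simp
  from measurable_comp[OF fm this] have "f \<in> borel_measurable (restrict_space M (space M - N))"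
    by (simp add: comp_def)
  then have "(\<lambda>x. if x \<in> space M - N then f x else 0) \<in> borel_measurable M"
    using N by (subst (asm) measurable_restrict_space_iff[of _ _ 0]) (auto simp: Int_absorb1)
  moreover have "inj_on (\<lambda>x. if x \<in> space M - N then f x else 0) (space M - N)"
    using f by (auto simp: bij_betw_def inj_on_def)
  ultimately show ?thesis using that N by blast
qed

text \<open>The countably many sets \<open>\<phi> < q\<close> with rational \<open>q\<close> separate the points of the space off a null
  set, and almost every \<open>x\<close> lies in the same ones of them as \<open>s x\<close>.\<close>

lemma (in lebesgue_prob_space) AE_eq_id_if_all_invariant:
  assumes s: "s \<in> pt_auts M" and inv: "\<And>A. A \<in> sets M \<Longrightarrow> AE x in M. s x \<in> A \<longleftrightarrow> x \<in> A"
  shows "AE x in M. s x = x"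
proof -
  obtain \<phi> :: "'a \<Rightarrow> real" and N where [measurable]: "\<phi> \<in> borel_measurable M"
    and N: "N \<in> null_sets M" and inj: "inj_on \<phi> (space M - N)"
    by (rule obtain_coordinate)
  have "AE x in M. \<forall>q\<in>\<rat>. s x \<in> {y \<in> space M. \<phi> y < q} \<longleftrightarrow> x \<in> {y \<in> space M. \<phi> y < q}"
    by (rule AE_ball_countable'[OF inv countable_rat]) measurable
  moreover note AE_not_in[OF N] pt_auts_AE[OF s AE_not_in[OF N]]
  ultimately show ?thesis
    using AE_space
  proof eventually_elim
    case (elim x)
    have sx: "s x \<in> space M" using elim(4) s by (simp add: pt_auts_space)
    have "\<phi> (s x) = \<phi> x"
    proof (rule ccontr)
      assume "\<phi> (s x) \<noteq> \<phi> x"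
      then have "min (\<phi> (s x)) (\<phi> x) < max (\<phi> (s x)) (\<phi> x)"
        by (auto simp: min_def max_def)
      then obtain q where "q \<in> \<rat>" "min (\<phi> (s x)) (\<phi> x) < q" "q < max (\<phi> (s x)) (\<phi> x)"
        using Rats_dense_in_real by blast
      then show False using elim(1,4) sx by (auto simp: min_def max_def split: if_splits)
    qed
    then show ?case using inj elim sx by (auto dest: inj_onD)
  qed
qed

text \<open>Off a null set, \<open>f\<close> and \<open>g\<close> agree where the real functions \<open>\<phi> \<circ> f\<close> and \<open>\<phi> \<circ> g\<close> agree;
  completeness of the measure absorbs the null set.\<close>

lemma (in lebesgue_prob_space) coincidence_set:
  assumes f: "f \<in> pt_auts M" and g: "g \<in> pt_auts M"
  shows "{x \<in> space M. f x = g x} \<in> sets M"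
proof -
  obtain \<phi> :: "'a \<Rightarrow> real" and N where \<phi> [measurable]: "\<phi> \<in> borel_measurable M"
    and N: "N \<in> null_sets M" and inj: "inj_on \<phi> (space M - N)"
    by (rule obtain_coordinate)
  have [measurable]: "f \<in> M \<rightarrow>\<^sub>M M" "g \<in> M \<rightarrow>\<^sub>M M"
    using f g by (auto intro: pt_auts_measurable)
  have E: "{x \<in> space M. \<phi> (f x) = \<phi> (g x)} \<in> sets M" by measurable
  have "AE x in M. x \<in> {x \<in> space M. \<phi> (f x) = \<phi> (g x)} \<longleftrightarrow> x \<in> {x \<in> space M. f x = g x}"
    using pt_auts_AE[OF f AE_not_in[OF N]] pt_auts_AE[OF g AE_not_in[OF N]] AE_space
    by eventually_elim (use inj f g in \<open>auto simp: pt_auts_space dest: inj_onD\<close>)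
  from in_sets_AE[OF this E] show ?thesis by auto
qed


section \<open>Closure under the full group\<close>

text \<open>The displacement by \<open>r\<close> is bounded by finitely many displacements by powers of \<open>s\<close> plus the
  measure of a tail set. The bound on the tail is uniform in the displaced set, hence along the
  whole sequence \<open>T\<^sup>n A\<close>. The function \<open>k\<close> may be non-measurable, so the tail sets are described by
  coincidence of \<open>r\<close> with powers of \<open>s\<close> and not by the values of \<open>k\<close>.\<close>

lemma (in lebesgue_prob_space) asymp_central_full:
  assumes t: "t \<in> pt_auts M" and s: "s \<in> pt_auts M" and r: "r \<in> pt_auts M"
    and st: "asymp_central M P t s"
    and k: "AE x in M. r x = (s [^]\<^bsub>pt_aut_group M\<^esub> (k x :: int)) x"
  shows "asymp_central M P t r"
  unfolding asymp_central_def
proof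
  fix A assume A: "A \<in> sets M"
  let ?F = "inf cofinite (principal P) :: int filter"
  let ?p = "\<lambda>j :: int. s [^]\<^bsub>pt_aut_group M\<^esub> j"
  let ?A = "\<lambda>n. (t [^]\<^bsub>pt_aut_group M\<^esub> (n :: int)) ` A"
  define B where "B J = {x \<in> space M. \<forall>j\<in>{- int J..int J}. r x \<noteq> ?p j x}" for J
  have p: "?p j \<in> pt_auts M" for j by (rule pow_pt_auts[OF s])
  have tA: "?A n \<in> sets M" for n by (rule pt_auts_image_sets[OF pow_pt_auts[OF t] A])
  have pt: "asymp_central M P t (?p j)" for j
    using group.subgroup_int_pow_closed[OF group_pt_aut_group asymp_central_subgroup[OF t], of s P j] s st
    by simp
  have Bs: "B J \<in> sets M" for J
  proof -
    have "B J = space M - (\<Union>j\<in>{- int J..int J}. {x \<in> space M. r x = ?p j x})"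
      by (auto simp: B_def)
    also have "\<dots> \<in> sets M"
      by (intro sets.Diff sets.top sets.finite_UN coincidence_set r p) auto
    finally show ?thesis .
  qed
  have "(\<lambda>J. measure M (B J)) \<longlonglongrightarrow> measure M (\<Inter>J. B J)"
    by (rule finite_Lim_measure_decseq) (use Bs in \<open>auto simp: decseq_def B_def\<close>)
  moreover have "measure M (\<Inter>J. B J) = 0"
  proof -
    have "AE x in M. x \<notin> (\<Inter>J. B J)"
      using k
    proof eventually_elim
      case (elim x)
      then have "x \<notin> B (nat \<bar>k x\<bar>)" by (auto simp: B_def intro!: bexI[of _ "k x"])
      then show ?case by blast
    qed
    moreover have "(\<Inter>J. B J) \<in> sets M" using Bs by (intro sets.countable_INT) auto
    ultimately have "(\<Inter>J. B J) \<in> null_sets M"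
      unfolding null_sets_iff_AE by (blast dest: sets.sets_into_space)
    then show ?thesis by (rule measure_eq_0_null_sets)
  qed
  ultimately have B0: "(\<lambda>J. measure M (B J)) \<longlonglongrightarrow> 0" by simp
  have le: "displacement M r C \<le> (\<Sum>j\<in>{- int J..int J}. displacement M (?p j) C) + measure M (B J)"
    if C: "C \<in> sets M" for C J
  proof -
    let ?D = "\<lambda>f. {x \<in> space M. (f x \<in> C) \<noteq> (x \<in> C)}"
    have U: "(\<Union>j\<in>{- int J..int J}. ?D (?p j)) \<in> sets M"
      by (intro sets.finite_UN displacement_sets p C) auto
    have "measure M (?D r) \<le> measure M ((\<Union>j\<in>{- int J..int J}. ?D (?p j)) \<union> B J)"
      by (rule finite_measure_mono) (use U Bs in \<open>auto simp: B_def\<close>)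
    also have "\<dots> \<le> measure M (\<Union>j\<in>{- int J..int J}. ?D (?p j)) + measure M (B J)"
      by (rule measure_Un_le[OF U Bs])
    also have "measure M (\<Union>j\<in>{- int J..int J}. ?D (?p j)) \<le> (\<Sum>j\<in>{- int J..int J}. measure M (?D (?p j)))"
      by (rule measure_UNION_le) (simp, rule displacement_sets[OF p C])
    finally show ?thesis by (simp add: displacement_def)
  qed
  show "((\<lambda>n. displacement M r (?A n)) \<longlongrightarrow> 0) ?F"
  proof (rule order_tendstoI)
    fix a :: real assume "a < 0"
    then show "\<forall>\<^sub>F n in ?F. a < displacement M r (?A n)"
      by (auto simp: displacement_def intro: always_eventually less_le_trans[OF _ measure_nonneg])
  next
    fix e :: real assume e: "0 < e"
    obtain J where J: "measure M (B J) < e / 2"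
      using order_tendstoD(2)[OF B0, of "e / 2"] e by (auto simp: eventually_sequentially)
    have "((\<lambda>n. \<Sum>j\<in>{- int J..int J}. displacement M (?p j) (?A n)) \<longlongrightarrow> 0) ?F"
      by (rule tendsto_null_sum) (use pt A in \<open>simp add: asymp_central_def\<close>)
    from order_tendstoD(2)[OF this, of "e / 2"] e
    have "\<forall>\<^sub>F n in ?F. (\<Sum>j\<in>{- int J..int J}. displacement M (?p j) (?A n)) < e / 2" by simp
    then show "\<forall>\<^sub>F n in ?F. displacement M r (?A n) < e"
    proof eventually_elim
      case (elim n)
      then show ?case using le[OF tA, of n J] J by linarith
    qed
  qed
qed

lemma (in lebesgue_prob_space) H_group_full:
  assumes t: "t \<in> pt_auts M"
  shows "full_group_family M (H_group M P (aut_class M t)) = H_group M P (aut_class M t)"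
    (is "_ = ?H")
proof
  interpret G: group "aut_group M" by (rule group_aut_group)
  have "full_group M S \<subseteq> ?H" if S: "S \<in> ?H" for S
  proof
    fix R assume R: "R \<in> full_group M S"
    then obtain k :: "'a \<Rightarrow> int"
      where k: "AE x in M. rep R x = (rep S [^]\<^bsub>pt_aut_group M\<^esub> k x) x"
        and Rc: "R \<in> carrier (aut_group M)"
      by (auto simp: full_group_def)
    have "asymp_central M P t (rep R)"
      using S Rc by (intro asymp_central_full[OF t _ _ _ k] rep_in_pt_auts)
        (auto simp: H_group_iff[OF t])
    with Rc show "R \<in> ?H" by (simp add: H_group_iff[OF t])
  qed
  then show "full_group_family M ?H \<subseteq> ?H"
    unfolding full_group_family_def
    by (intro G.generate_subgroup_incl[OF _ H_group_subgroup[OF t]]) blast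
  show "?H \<subseteq> full_group_family M ?H"
  proof
    fix S assume S: "S \<in> ?H"
    then have "rep S \<in> pt_auts M" by (auto simp: H_group_iff[OF t] intro: rep_in_pt_auts)
    then have "S \<in> full_group M S"
      using S group.int_pow_1[OF group_pt_aut_group, of "rep S" M]
      by (auto simp: full_group_def H_group_iff[OF t] intro!: exI[of _ "\<lambda>_. 1"])
    then show "S \<in> full_group_family M ?H"
      using S by (auto simp: full_group_family_def intro: generate.incl)
  qed
qed


section \<open>Prime automorphisms\<close>

text \<open>Primeness is applied to the \<open>\<sigma>\<close>-algebra of \<open>H\<close>-invariant sets: its two possible values are
  ergodicity and triviality of \<open>H\<close>. Since primeness speaks of images under the chosen
  representative of \<open>T\<close>, that representative is also the point map \<open>u\<close> used for \<open>H\<close>.\<close>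

lemma (in lebesgue_prob_space) ergodic_or_trivial_if_prime:
  assumes T: "T \<in> carrier (aut_group M)" and prime: "prime_aut M T"
  shows "ergodic_subgroup M (H_group M P T) \<or>
    H_group M P T = {\<one>\<^bsub>aut_group M\<^esub>}"
proof -
  interpret Gp: group "pt_aut_group M" by (rule group_pt_aut_group)
  interpret c: group_hom "pt_aut_group M" "aut_group M" "aut_class M" by (rule aut_class_hom)
  let ?H = "H_group M P T"
  define u where "u = rep T"
  define K where "K = {s \<in> pt_auts M. asymp_central M P u s}"
  let ?I = "invariant_sets M K"
  let ?iu = "inv\<^bsub>pt_aut_group M\<^esub> u"
  have u: "u \<in> pt_auts M" unfolding u_def by (rule rep_in_pt_auts[OF T])
  have cu: "aut_class M u = T" unfolding u_def by (rule aut_class_rep[OF T])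
  have subgroup: "subgroup ?H (aut_group M)"
    using H_group_subgroup[OF u] by (simp add: cu)
  have Kp: "K \<subseteq> pt_auts M" by (auto simp: K_def)
  have repK: "rep S \<in> K" if "S \<in> ?H" for S
    using that H_group_iff[OF u, of S P] by (auto simp: cu K_def intro: rep_in_pt_auts)
  have KH: "aut_class M s \<in> ?H" if "s \<in> K" for s
    using that aut_class_in_H_group_iff[OF u, of s P] by (simp add: cu K_def)
  \<comment> \<open>Both \<open>u\<close> and its inverse commute with all powers of \<open>u\<close>, so conjugation by either one
    maps \<open>K\<close> into itself. The inverse is needed to make \<open>u\<close> map the invariant sets onto, and
    not just into, themselves.\<close>
  have pow1: "u [^]\<^bsub>pt_aut_group M\<^esub> (1 :: int) = u" using u by simp
  have comm: "u \<otimes>\<^bsub>pt_aut_group M\<^esub> u [^]\<^bsub>pt_aut_group M\<^esub> n = u [^]\<^bsub>pt_aut_group M\<^esub> n \<otimes>\<^bsub>pt_aut_group M\<^esub> u"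
    for n :: int
    using Gp.int_pow_mult[of u 1 n] Gp.int_pow_mult[of u n 1] u by (simp add: pow1 add.commute)
  have commi: "?iu \<otimes>\<^bsub>pt_aut_group M\<^esub> u [^]\<^bsub>pt_aut_group M\<^esub> n = u [^]\<^bsub>pt_aut_group M\<^esub> n \<otimes>\<^bsub>pt_aut_group M\<^esub> ?iu"
    for n :: int
    using Gp.int_pow_mult[of u "-1" n] Gp.int_pow_mult[of u n "-1"] Gp.int_pow_neg[of u 1] u
    by (simp add: pow1 add.commute)
  have iu: "?iu \<in> pt_auts M" by (rule inv_pt_auts[OF u])
  have img: "u ` A \<in> ?I" "?iu ` A \<in> ?I" if "A \<in> ?I" for A
  proof -
    show "u ` A \<in> ?I"
      by (rule image_in_invariant_sets[OF Kp u _ that])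
        (use u asymp_central_conj[OF u _ _ u comm] in \<open>auto simp: K_def mult_pt_auts inv_pt_auts\<close>)
    show "?iu ` A \<in> ?I"
      by (rule image_in_invariant_sets[OF Kp iu _ that])
        (use iu asymp_central_conj[OF u _ _ iu commi] in \<open>auto simp: K_def mult_pt_auts inv_pt_auts\<close>)
  qed
  have "(\<lambda>A. u ` A) ` ?I = ?I"
  proof (intro equalityI subsetI)
    fix A assume A: "A \<in> ?I"
    then have "A \<subseteq> space M" by (auto simp: invariant_sets_def dest: sets.sets_into_space)
    then have "u ` ?iu ` A = A" using inv_apply_right[OF u] by (force simp: image_image)
    then show "A \<in> (\<lambda>A. u ` A) ` ?I" using img(2)[OF A] by (metis image_eqI)
  qed (use img(1) in auto)
  then have "?I = {A \<in> sets M. measure M A = 0 \<or> measure M A = 1} \<or> ?I = sets M"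
    using prime invariant_sets_sigma_algebra[OF Kp] null_sets_subset_invariant_sets[OF Kp]
    by (auto simp: prime_aut_def u_def[symmetric] invariant_sets_def)
  then show ?thesis
  proof
    assume triv: "?I = {A \<in> sets M. measure M A = 0 \<or> measure M A = 1}"
    have "measure M A \<in> {0, 1}"
      if A: "A \<in> sets M" and z: "\<forall>S\<in>?H. measure M (sym_diff (rep S ` A) A) = 0" for A
    proof -
      have "displacement M s A = 0" if s: "s \<in> K" for s
      proof -
        have sp: "s \<in> pt_auts M" using s Kp by auto
        note r = rep_aut_class[OF sp]
        show ?thesis
          using z KH[OF s] measure_image_sym_diff[OF r(1) A] displacement_cong_AE[OF r(1) sp r(2) A]
          by simp
      qed
      then have "A \<in> ?I"
        using A Kp displacement_eq_0_iff[OF _ A] by (auto simp: invariant_sets_def subset_iff)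
      with triv show ?thesis by auto
    qed
    then show ?thesis using subgroup by (simp add: ergodic_subgroup_def)
  next
    assume all: "?I = sets M"
    have "S = \<one>\<^bsub>aut_group M\<^esub>" if S: "S \<in> ?H" for S
    proof -
      have Sc: "S \<in> carrier (aut_group M)" using S by (simp add: H_group_def)
      have "AE x in M. rep S x \<in> A \<longleftrightarrow> x \<in> A" if "A \<in> sets M" for A
        using that repK[OF S] unfolding all[symmetric] by (simp add: invariant_sets_def)
      then have "AE x in M. rep S x = x"
        by (rule AE_eq_id_if_all_invariant[OF rep_in_pt_auts[OF Sc]])
      then have "AE x in M. rep S x = \<one>\<^bsub>pt_aut_group M\<^esub> x"
        using AE_space by eventually_elim (simp add: one_apply)
      then have "aut_class M (rep S) = aut_class M \<one>\<^bsub>pt_aut_group M\<^esub>"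
        using Gp.one_closed by (intro aut_class_eqI rep_in_pt_auts[OF Sc]) simp_all
      then show ?thesis by (simp add: aut_class_rep[OF Sc])
    qed
    moreover have "\<one>\<^bsub>aut_group M\<^esub> \<in> ?H"
      by (rule subgroup.one_closed[OF subgroup])
    ultimately show ?thesis by blast
  qed
qed

theorem theorem1:
  fixes M :: "'a measure" and T :: "('a \<Rightarrow> 'a) set"
  assumes "lebesgue_prob_space M"
    and "T \<in> carrier (aut_group M)"
  shows "(prime_aut M T \<longrightarrow>
           (\<forall>P :: int set. infinite P \<longrightarrow>
              ergodic_subgroup M (H_group M P T) \<or> H_group M P T = {\<one>\<^bsub>aut_group M\<^esub>})) \<and>
         (\<forall>P :: int set. infinite P \<longrightarrow>
           H_group M P T = full_group_family M (H_group M P T))"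
proof -
  interpret lebesgue_prob_space M by (rule assms(1))
  note t = rep_in_pt_auts[OF assms(2)] and T = aut_class_rep[OF assms(2)]
  show ?thesis
    using ergodic_or_trivial_if_prime[OF assms(2)] H_group_full[OF t] unfolding T by simp
qed

end
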